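(* Let $G=(V,E)$ be a connected, locally finite, simple, unweighted $C_4$-free graph with minimum degree $\delta(G)\ge 2$, equipped with the normalized Laplacian $\Delta f(x)=\frac{1}{d_x}\sum_{y\sim x}(f(y)-f(x))$ where $d_x$ is the degree of $x$. Then $G$ satisfies the curvature dimension condition $CD(0,\infty)$ if and only if $G$ is one of the following: (1) a cycle $C_n$ with $n\ge 5$, or the infinite line $P_{\mathbb Z}$; (2) a friendship graph $F_k$ with $1\le k\le 7$.
   Context: $G$ is $C_4$-free if it contains no cycle of length $4$ as a subgraph. For $f,g:V\to\mathbb R$ define $2\Gamma(f,g)=\Delta(fg)-f\Delta g-g\Delta f$ and $2\Gamma_2(f,g)=\Delta\Gamma(f,g)-\Gamma(f,\Delta g)-\Gamma(\Delta f,g)$, with $\Gamma_2(f)=\Gamma_2(f,f)$. $G$ satisfies $CD(0,\infty)$ if $\Gamma_2(f)(x)\ge 0$ for every $f:V\to\mathbb R$ and every $x\in V$. $P_{\mathbb Z}$ is the two-sided infinite path. The friendship graph $F_k$ is the graph obtained from $k$ triangles by identifying one vertex of each into a single common vertex (so $F_1=C_3$). *)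

theory Defs
  imports Complex_Main "Graph_Theory.Graph_Theory"
begin

text \<open>
  Undirected simple graphs, possibly infinite, are symmetric loop-free digraphs whose arcs are
  pairs of vertices (locale \<^locale>\<open>pair_bidirected_digraph\<close>). An edge \<open>{x, y}\<close> is the pair of arcs
  \<open>(x, y)\<close>, \<open>(y, x)\<close>, so that the degree of a vertex is its \<^const>\<open>out_degree\<close>.
\<close>

definition locally_finite_graph :: "'a pair_pre_digraph \<Rightarrow> bool" where
  "locally_finite_graph G \<longleftrightarrow> (\<forall>x \<in> pverts G. finite (out_arcs (with_proj G) x))"

definition cycle_graph :: "nat \<Rightarrow> nat pair_pre_digraph" where
  "cycle_graph n = \<lparr> pverts = {..<n},
     parcs = {(i, j). i < n \<and> j < n \<and> (j = Suc i mod n \<or> i = Suc j mod n)} \<rparr>"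

definition infinite_line :: "int pair_pre_digraph" where
  "infinite_line = \<lparr> pverts = UNIV, parcs = {(i, j). \<bar>i - j\<bar> = 1} \<rparr>"

text \<open>\<^term>\<open>None\<close> is the vertex shared by all triangles.\<close>

definition friendship_triangle :: "nat \<Rightarrow> (nat \<times> bool) option set" where
  "friendship_triangle i = {None, Some (i, False), Some (i, True)}"

definition friendship_graph :: "nat \<Rightarrow> (nat \<times> bool) option pair_pre_digraph" where
  "friendship_graph k = \<lparr> pverts = (\<Union>i<k. friendship_triangle i),
     parcs = (\<Union>i<k. {(u, v). u \<in> friendship_triangle i \<and> v \<in> friendship_triangle i \<and> u \<noteq> v}) \<rparr>"

definition C4_free :: "'a pair_pre_digraph \<Rightarrow> bool" where
  "C4_free G \<longleftrightarrow>
     \<not> (\<exists>H. subgraph H (with_proj G) \<and> digraph_iso (with_proj (cycle_graph 4)) H)"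

text \<open>
  Functions on the vertex set are represented by total functions on the vertex type; at a vertex of
  a well-formed graph the operators below only depend on the values at vertices.
\<close>

definition laplacian :: "'a pair_pre_digraph \<Rightarrow> ('a \<Rightarrow> real) \<Rightarrow> 'a \<Rightarrow> real" where
  "laplacian G f x =
     1 / real (out_degree (with_proj G) x) * (\<Sum>y | (x, y) \<in> parcs G. f y - f x)"

definition Gamma_op :: "'a pair_pre_digraph \<Rightarrow> ('a \<Rightarrow> real) \<Rightarrow> ('a \<Rightarrow> real) \<Rightarrow> 'a \<Rightarrow> real" where
  "Gamma_op G f g x =
     (laplacian G (\<lambda>y. f y * g y) x - f x * laplacian G g x - g x * laplacian G f x) / 2"

definition Gamma2_op :: "'a pair_pre_digraph \<Rightarrow> ('a \<Rightarrow> real) \<Rightarrow> ('a \<Rightarrow> real) \<Rightarrow> 'a \<Rightarrow> real" where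
  "Gamma2_op G f g x =
     (laplacian G (Gamma_op G f g) x - Gamma_op G f (laplacian G g) x
        - Gamma_op G (laplacian G f) g x) / 2"

definition CD_0_infinity :: "'a pair_pre_digraph \<Rightarrow> bool" where
  "CD_0_infinity G \<longleftrightarrow> (\<forall>f. \<forall>x \<in> pverts G. Gamma2_op G f f x \<ge> 0)"

end

theory Submission
  imports Defs
begin

text \<open>
  For \<open>f x = 0\<close> one has
  \<open>4 d\<^sub>x \<Gamma>\<^sub>2(f)(x) = \<Sum>y\<sim>x. (1/d\<^sub>y \<Sum>z\<sim>y. (f z - 2 f y)\<^sup>2 - 2 (f y)\<^sup>2) + 2/d\<^sub>x (\<Sum>y\<sim>x. f y)\<^sup>2\<close>.
  If all neighbours of \<open>x\<close> have degree 2, the terms with \<open>z = x\<close> already make this nonnegative.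
  In a \<open>C\<^sub>4\<close>-free graph the neighbours of \<open>x\<close> induce a matching and the terms at distance two can be
  made to vanish, which leaves a quadratic form on the neighbours of \<open>x\<close>. Testing it with explicit
  vectors shows that all edges at a vertex of degree at least 3 lie in triangles and that two such
  vertices are never adjacent. Hence the graph is either 2-regular, that is a cycle or a line, or a
  friendship graph; at a leaf of a friendship graph the form is nonnegative iff the degree of the
  centre is at most 15.
\<close>

section \<open>Neighbourhoods and isomorphisms of pair digraphs\<close>

definition nbs :: "'a pair_pre_digraph \<Rightarrow> 'a \<Rightarrow> 'a set" where
  "nbs G x = {y. (x, y) \<in> parcs G}"

abbreviation deg :: "'a pair_pre_digraph \<Rightarrow> 'a \<Rightarrow> nat" where
  "deg G x \<equiv> card (nbs G x)"

lemma out_arcs_eq_nbs: "out_arcs (with_proj G) x = Pair x ` nbs G x"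
  by (auto simp: out_arcs_def nbs_def)

lemma out_degree_eq_deg: "out_degree (with_proj G) x = deg G x"
  by (simp add: out_degree_def out_arcs_eq_nbs card_image inj_on_def)

lemma finite_out_arcs_iff: "finite (out_arcs (with_proj G) x) \<longleftrightarrow> finite (nbs G x)"
  by (simp add: out_arcs_eq_nbs finite_image_iff inj_on_def)

text \<open>Arcs are pairs of their end points, so on arcs an isomorphism is forced to act as
  \<open>map_prod f f\<close> for its vertex map \<open>f\<close>. All later arguments can therefore
  work with vertex bijections that preserve and reflect adjacency.\<close>

lemma digraph_iso_with_proj_iff:
  assumes G: "pair_wf_digraph G" and H: "pair_wf_digraph H"
  shows "digraph_iso (with_proj G) (with_proj H) \<longleftrightarrow>
    (\<exists>f. bij_betw f (pverts G) (pverts H) \<and>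
       (\<forall>u\<in>pverts G. \<forall>v\<in>pverts G. (u, v) \<in> parcs G \<longleftrightarrow> (f u, f v) \<in> parcs H))"
    (is "?L \<longleftrightarrow> ?R")
proof
  assume ?L
  then obtain h where h: "pre_digraph.digraph_isomorphism (with_proj G) h"
    and H_eq: "with_proj H = app_iso h (with_proj G)"
    unfolding digraph_iso_def by blast
  let ?f = "iso_verts h"
  have V: "pverts H = ?f ` pverts G" and A: "parcs H = iso_arcs h ` parcs G"
    and tl: "iso_tail h = fst" and hd: "iso_head h = snd"
    using arg_cong[OF H_eq, of verts] arg_cong[OF H_eq, of arcs]
      arg_cong[OF H_eq, of tail] arg_cong[OF H_eq, of head] by simp_all
  have inj: "inj_on ?f (pverts G)"
    using h by (simp add: pre_digraph.digraph_isomorphism_def)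
  have arc: "iso_arcs h (u, v) = (?f u, ?f v)" if "(u, v) \<in> parcs G" for u v
  proof -
    have "?f u = fst (iso_arcs h (u, v))" "?f v = snd (iso_arcs h (u, v))"
      using h that by (auto simp: pre_digraph.digraph_isomorphism_def tl hd)
    then show ?thesis by simp
  qed
  have "(u, v) \<in> parcs G" if uv: "u \<in> pverts G" "v \<in> pverts G" and "(?f u, ?f v) \<in> parcs H" for u v
  proof -
    obtain u' v' where a: "(u', v') \<in> parcs G" "(?f u, ?f v) = iso_arcs h (u', v')"
      using \<open>(?f u, ?f v) \<in> parcs H\<close> unfolding A by auto
    then have "?f u = ?f u'" "?f v = ?f v'" using arc by auto
    moreover have "u' \<in> pverts G" "v' \<in> pverts G"
      using pair_wf_digraph.in_arcsD1[OF G a(1)] pair_wf_digraph.in_arcsD2[OF G a(1)] .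
    ultimately show ?thesis using inj uv a(1) by (auto dest: inj_onD)
  qed
  moreover have "(?f u, ?f v) \<in> parcs H" if "(u, v) \<in> parcs G" for u v
    using arc[OF that] that unfolding A by (metis imageI)
  ultimately show ?R using inj V by (intro exI[of _ ?f]) (auto simp: bij_betw_def)
next
  assume ?R
  then obtain f where f: "bij_betw f (pverts G) (pverts H)"
    and arc: "\<And>u v. u \<in> pverts G \<Longrightarrow> v \<in> pverts G \<Longrightarrow> (u, v) \<in> parcs G \<longleftrightarrow> (f u, f v) \<in> parcs H"
    by blast
  have inj: "inj_on f (pverts G)" and im: "f ` pverts G = pverts H"
    using f by (auto simp: bij_betw_def)
  define h where "h = \<lparr>iso_verts = f, iso_arcs = map_prod f f, iso_head = snd, iso_tail = fst\<rparr>"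
  have sub: "parcs G \<subseteq> pverts G \<times> pverts G"
    using pair_wf_digraph.in_arcsD1[OF G] pair_wf_digraph.in_arcsD2[OF G] by auto
  have subH: "parcs H \<subseteq> pverts H \<times> pverts H"
    using pair_wf_digraph.in_arcsD1[OF H] pair_wf_digraph.in_arcsD2[OF H] by auto
  have "inj_on (map_prod f f) (parcs G)"
    using map_prod_inj_on[OF inj inj] sub by (rule inj_on_subset)
  then have "pre_digraph.digraph_isomorphism (with_proj G) h"
    using G inj by (auto simp: pre_digraph.digraph_isomorphism_def h_def wf_digraph_wp_iff)
  moreover have "map_prod f f ` parcs G = parcs H"
  proof (intro equalityI subsetI)
    fix e assume "e \<in> map_prod f f ` parcs G"
    then show "e \<in> parcs H" using arc sub by auto
  next
    fix e assume e: "e \<in> parcs H"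
    then obtain u v where "u \<in> pverts G" "v \<in> pverts G" "e = (f u, f v)"
      using subH im by blast
    then show "e \<in> map_prod f f ` parcs G" using arc e by (metis imageI map_prod_simp)
  qed
  then have "with_proj H = app_iso h (with_proj G)"
    by (simp add: app_iso_def h_def with_proj_def im)
  ultimately show ?L unfolding digraph_iso_def by blast
qed

lemma deg_bij_betw:
  assumes G: "pair_wf_digraph G" and H: "pair_wf_digraph H"
    and f: "bij_betw f (pverts G) (pverts H)"
    and arc: "\<forall>u\<in>pverts G. \<forall>v\<in>pverts G. (u, v) \<in> parcs G \<longleftrightarrow> (f u, f v) \<in> parcs H"
    and x: "x \<in> pverts G"
  shows "deg H (f x) = deg G x"
proof -
  have sub: "nbs G x \<subseteq> pverts G" 
    using pair_wf_digraph.in_arcsD2[OF G] by (auto simp: nbs_def)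
  have subH: "nbs H (f x) \<subseteq> f ` pverts G" 
    using pair_wf_digraph.in_arcsD2[OF H] f by (auto simp: nbs_def bij_betw_def)
  have "f ` nbs G x = nbs H (f x)"
    using sub subH arc x by (fastforce simp: nbs_def)
  moreover have "inj_on f (nbs G x)"
    using f sub by (meson bij_betw_def inj_on_subset)
  ultimately show ?thesis by (metis card_image)
qed

section \<open>The cycles, the line and the friendship graphs\<close>

lemma pair_wf_cycle_graph: "pair_wf_digraph (cycle_graph n)"
  by unfold_locales (auto simp: cycle_graph_def)

lemma pair_wf_infinite_line: "pair_wf_digraph infinite_line"
  by unfold_locales (auto simp: infinite_line_def)

lemma pair_wf_friendship_graph: "pair_wf_digraph (friendship_graph k)"
  by unfold_locales (auto simp: friendship_graph_def)

lemma deg_infinite_line: "deg infinite_line i = 2"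
proof -
  have "nbs infinite_line i = {i - 1, i + 1}"
    by (auto simp: nbs_def infinite_line_def)
  then show ?thesis by simp
qed

text \<open>With fewer than three vertices, successor and predecessor modulo \<open>n\<close>
  coincide.\<close>

lemma deg_cycle_graph:
  assumes "3 \<le> n" "i < n"
  shows "deg (cycle_graph n) i = 2"
proof -
  let ?p = "if i = 0 then n - 1 else i - 1"
  have "nbs (cycle_graph n) i = {Suc i mod n, ?p}"
    using assms by (auto simp: nbs_def cycle_graph_def mod_Suc)
  moreover have "Suc i mod n \<noteq> ?p"
    using assms by (auto simp: mod_Suc)
  ultimately show ?thesis by simp
qed

lemma nbs_friendship_graph_Some:
  assumes "i < k"
  shows "nbs (friendship_graph k) (Some (i, b)) = {None, Some (i, \<not> b)}"
  using assms by (cases b) (auto simp: nbs_def friendship_graph_def friendship_triangle_def)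

lemma deg_friendship_graph_None: "deg (friendship_graph k) None = 2 * k"
proof -
  have "nbs (friendship_graph k) None = Some ` ({..<k} \<times> UNIV)"
    by (auto simp: nbs_def friendship_graph_def friendship_triangle_def image_iff)
  moreover have "card (Some ` ({..<k} \<times> (UNIV::bool set))) = 2 * k"
    by (subst card_image) (auto simp: card_cartesian_product)
  ultimately show ?thesis by simp
qed

text \<open>For \<open>k = 0\<close> the union over the triangles is empty, and not even
  \<open>None\<close> is a vertex.\<close>

lemma pverts_friendship_graph:
  "0 < k \<Longrightarrow> pverts (friendship_graph k) = insert None (Some ` ({..<k} \<times> UNIV))"
  by (auto simp: friendship_graph_def friendship_triangle_def image_iff)

section \<open>Gamma_2 as a sum over neighbours\<close>

lemma laplacian_nbs: "laplacian G f x = (\<Sum>y\<in>nbs G x. f y - f x) / deg G x"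
  by (simp add: laplacian_def out_degree_eq_deg nbs_def)

lemma Gamma_op_eq:
  "Gamma_op G f g x = (\<Sum>y\<in>nbs G x. (f y - f x) * (g y - g x)) / (2 * deg G x)"
proof -
  have "(\<Sum>y\<in>nbs G x. (f y - f x) * (g y - g x)) =
    (\<Sum>y\<in>nbs G x. (f y * g y - f x * g x) - f x * (g y - g x) - g x * (f y - f x))"
    by (intro sum.cong refl) algebra
  also have "\<dots> = (\<Sum>y\<in>nbs G x. f y * g y - f x * g x) - f x * (\<Sum>y\<in>nbs G x. g y - g x)
      - g x * (\<Sum>y\<in>nbs G x. f y - f x)"
    by (simp only: sum_distrib_left) (simp only: sum_subtractf)
  finally have eq: "(\<Sum>y\<in>nbs G x. (f y - f x) * (g y - g x)) = \<dots>" .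
  show ?thesis
    unfolding Gamma_op_def laplacian_nbs eq by (simp add: diff_divide_distrib mult.commute)
qed

lemma Gamma_op_commute: "Gamma_op G f g x = Gamma_op G g f x"
  by (simp add: Gamma_op_def mult.commute)

text \<open>Grouping by the neighbours \<open>y\<close> of \<open>x\<close> leaves
  \<open>2 * Gamma_op G f f y - 2 * (f y - f x) * laplacian G f y\<close> for each of them.
  Completing the square applies because \<open>f z - f x - 2 * (f y - f x)\<close> equals
  \<open>(f z - f y) - (f y - f x)\<close>.\<close>

lemma Gamma2_op_eq:
  assumes dx: "deg G x \<noteq> 0" and dy: "\<And>y. y \<in> nbs G x \<Longrightarrow> deg G y \<noteq> 0"
  shows "4 * real (deg G x) * Gamma2_op G f f x =
    (\<Sum>y\<in>nbs G x. (\<Sum>z\<in>nbs G y. (f z - f x - 2 * (f y - f x))\<^sup>2) / deg G y - 2 * (f y - f x)\<^sup>2)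
    + 2 / deg G x * (\<Sum>y\<in>nbs G x. f y - f x)\<^sup>2"
proof -
  let ?d = "\<lambda>y. real (deg G y)" and ?L = "laplacian G f"
  have inner: "2 * Gamma_op G f f y - 2 * (f y - f x) * ?L y =
      (\<Sum>z\<in>nbs G y. (f z - f x - 2 * (f y - f x))\<^sup>2) / ?d y - (f y - f x)\<^sup>2"
    if y: "y \<in> nbs G x" for y
  proof -
    have "(\<Sum>z\<in>nbs G y. (f z - f x - 2 * (f y - f x))\<^sup>2) =
      (\<Sum>z\<in>nbs G y. (f z - f y) * (f z - f y) - 2 * (f y - f x) * (f z - f y) + (f y - f x)\<^sup>2)"
      by (intro sum.cong refl) algebra
    also have "\<dots> = (\<Sum>z\<in>nbs G y. (f z - f y) * (f z - f y))
        - 2 * (f y - f x) * (\<Sum>z\<in>nbs G y. f z - f y) + ?d y * (f y - f x)\<^sup>2"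
      unfolding sum_distrib_left by (simp add: sum.distrib sum_subtractf)
    finally show ?thesis
      using dy[OF y] by (simp add: Gamma_op_eq laplacian_nbs field_simps)
  qed
  \<comment> \<open>The term \<open>Gamma_op G f f x\<close> supplies one of the two subtracted
    squares \<open>(f y - f x)\<^sup>2\<close>; the other one comes from completing the square in
    \<open>inner\<close>.\<close>
  have Gx: "2 * ?d x * Gamma_op G f f x = (\<Sum>y\<in>nbs G x. (f y - f x)\<^sup>2)"
    using dx by (simp add: Gamma_op_eq power2_eq_square)
  have "4 * ?d x * Gamma2_op G f f x =
    2 * ?d x * laplacian G (Gamma_op G f f) x - 2 * (2 * ?d x * Gamma_op G f ?L x)"
    unfolding Gamma2_op_def Gamma_op_commute[of G ?L f] by (simp add: field_simps)
  also have "2 * ?d x * laplacian G (Gamma_op G f f) x =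
      2 * (\<Sum>y\<in>nbs G x. Gamma_op G f f y - Gamma_op G f f x)"
    using dx by (simp add: laplacian_nbs)
  also have "\<dots> = (\<Sum>y\<in>nbs G x. 2 * Gamma_op G f f y) - 2 * ?d x * Gamma_op G f f x"
    by (simp add: sum_subtractf sum_distrib_left algebra_simps)
  also have "2 * ?d x * Gamma_op G f ?L x = (\<Sum>y\<in>nbs G x. (f y - f x) * (?L y - ?L x))"
    using dx by (simp add: Gamma_op_eq)
  also have "\<dots> = (\<Sum>y\<in>nbs G x. (f y - f x) * ?L y) - ?L x * (\<Sum>y\<in>nbs G x. f y - f x)"
    by (simp add: sum_distrib_left sum_subtractf[symmetric] algebra_simps)
  also have "(\<Sum>y\<in>nbs G x. 2 * Gamma_op G f f y) - 2 * ?d x * Gamma_op G f f x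
      - 2 * ((\<Sum>y\<in>nbs G x. (f y - f x) * ?L y) - ?L x * (\<Sum>y\<in>nbs G x. f y - f x)) =
     (\<Sum>y\<in>nbs G x. 2 * Gamma_op G f f y - 2 * (f y - f x) * ?L y - (f y - f x)\<^sup>2)
     + 2 * ?L x * (\<Sum>y\<in>nbs G x. f y - f x)"
    unfolding Gx by (simp only: sum_subtractf right_diff_distrib sum_distrib_left mult.assoc) (simp add: algebra_simps)
  also have "2 * ?L x * (\<Sum>y\<in>nbs G x. f y - f x) = 2 / ?d x * (\<Sum>y\<in>nbs G x. f y - f x)\<^sup>2"
    using dx by (simp add: laplacian_nbs power2_eq_square)
  also have "(\<Sum>y\<in>nbs G x. 2 * Gamma_op G f f y - 2 * (f y - f x) * ?L y - (f y - f x)\<^sup>2) =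
    (\<Sum>y\<in>nbs G x. (\<Sum>z\<in>nbs G y. (f z - f x - 2 * (f y - f x))\<^sup>2) / ?d y - 2 * (f y - f x)\<^sup>2)"
  proof (intro sum.cong refl)
    fix y assume "y \<in> nbs G x"
    from inner[OF this] show "2 * Gamma_op G f f y - 2 * (f y - f x) * ?L y - (f y - f x)\<^sup>2 =
      (\<Sum>z\<in>nbs G y. (f z - f x - 2 * (f y - f x))\<^sup>2) / ?d y - 2 * (f y - f x)\<^sup>2"
      by linarith
  qed
  finally show ?thesis .
qed

section \<open>Connectedness and common neighbours in C4-free graphs\<close>

locale c4_free_graph = pair_bidirected_digraph G for G :: "'a pair_pre_digraph" +
  assumes conn: "Digraph_Component.connected (with_proj G)"
    and loc_fin: "locally_finite_graph G"
    and c4: "C4_free G"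
    and min_degree: "\<forall>x \<in> pverts G. 2 \<le> out_degree (with_proj G) x"
begin

lemma finite_nbs: "x \<in> pverts G \<Longrightarrow> finite (nbs G x)"
  using loc_fin by (simp add: locally_finite_graph_def finite_out_arcs_iff)

lemma deg_ge_2: "x \<in> pverts G \<Longrightarrow> 2 \<le> deg G x"
  using min_degree by (simp add: out_degree_eq_deg)

lemma nbs_sym: "y \<in> nbs G x \<Longrightarrow> x \<in> nbs G y"
  by (simp add: nbs_def arcs_symmetric)

lemma nbs_neq: "y \<in> nbs G x \<Longrightarrow> y \<noteq> x"
  using pair_no_loops by (force simp: nbs_def)

lemma nbs_in_verts: "y \<in> nbs G x \<Longrightarrow> y \<in> pverts G"
  using in_arcsD2 by (auto simp: nbs_def)

text \<open>Arcs are symmetric, so connectedness gives a directed path from a vertex of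
  \<open>S\<close> to any other vertex, and induction along it stays in \<open>S\<close>. Later this
  identifies the whole graph with a closed neighbourhood or with the range of a walk.\<close>

lemma verts_eqI:
  assumes "S \<subseteq> pverts G" "S \<noteq> {}" and closed: "\<And>x. x \<in> S \<Longrightarrow> nbs G x \<subseteq> S"
  shows "S = pverts G"
proof
  show "pverts G \<subseteq> S"
  proof
    fix v assume v: "v \<in> pverts G"
    obtain u where u: "u \<in> S" "u \<in> pverts G" using assms by blast
    have "strongly_connected (with_proj G)"
      using conn pair_sym_arcs by (rule symmetric_connected_imp_strongly_connected[rotated])
    then have "u \<rightarrow>\<^sup>*\<^bsub>with_proj G\<^esub> v"
      using u v by (simp add: strongly_connected_def)
    then have "(u, v) \<in> rtrancl_on (pverts G) (parcs G)"
      by (simp add: reachable_def)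
    then show "v \<in> S"
      by (induction rule: rtrancl_on_induct) (use u closed in \<open>auto simp: nbs_def\<close>)
  qed
qed fact

text \<open>Only the diagonals need to be assumed distinct, as loop-freeness separates consecutive
  vertices. Chords do no harm, because a subgraph need not be induced.\<close>

lemma no_C4:
  assumes "a \<noteq> c" "b \<noteq> d" "b \<in> nbs G a" "c \<in> nbs G b" "d \<in> nbs G c" "a \<in> nbs G d"
  shows False
proof -
  have ne: "a \<noteq> b" "b \<noteq> c" "c \<noteq> d" "d \<noteq> a" using assms nbs_neq by blast+
  define H where "H = \<lparr>pverts = {a, b, c, d},
    parcs = {(a, b), (b, a), (b, c), (c, b), (c, d), (d, c), (d, a), (a, d)}\<rparr>"
  have wfH: "pair_wf_digraph H"
    by unfold_locales (auto simp: H_def)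
  have sub: "subgraph (with_proj H) (with_proj G)"
    using wfH wf_digraph assms nbs_sym[OF assms(3)] nbs_sym[OF assms(4)] nbs_sym[OF assms(5)]
      nbs_sym[OF assms(6)] nbs_in_verts
    by (auto simp: subgraph_def wf_digraph_wp_iff compatible_def H_def nbs_def)
  let ?f = "(!) [a, b, c, d]"
  have four: "{..<4} = {0, 1, 2, 3::nat}" by auto
  have "bij_betw ?f (pverts (cycle_graph 4)) (pverts H)"
    using assms(1,2) ne by (auto simp: bij_betw_def cycle_graph_def H_def four)
  moreover have "\<forall>u\<in>pverts (cycle_graph 4). \<forall>v\<in>pverts (cycle_graph 4).
      (u, v) \<in> parcs (cycle_graph 4) \<longleftrightarrow> (?f u, ?f v) \<in> parcs H"
    using assms(1,2) ne by (auto simp: cycle_graph_def H_def four)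
  ultimately have "digraph_iso (with_proj (cycle_graph 4)) (with_proj H)"
    using digraph_iso_with_proj_iff[OF pair_wf_cycle_graph wfH] by blast
  then show False using c4 sub by (auto simp: C4_free_def)
qed

text \<open>A second common neighbour would close a 4-cycle through \<open>x\<close> and
  \<open>x'\<close>. The local analysis uses C4-freeness in this form.\<close>

lemma common_nb_unique:
  assumes "x \<noteq> x'" "y \<in> nbs G x" "y \<in> nbs G x'" "z \<in> nbs G x" "z \<in> nbs G x'"
  shows "y = z"
  using no_C4[of x x' y z] assms nbs_sym by blast

section \<open>The quadratic form at a vertex\<close>

text \<open>With the reciprocal degrees as atoms, the value of the form at a fixed test vector is a
  linear expression, so lower bounds on degrees refute its nonnegativity by linear
  arithmetic.\<close>

definition inv_deg :: "'a \<Rightarrow> real" where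
  "inv_deg x = 1 / real (deg G x)"

lemma inv_deg_nonneg: "0 \<le> inv_deg x"
  by (simp add: inv_deg_def)

lemma inv_deg_le:
  assumes "n \<le> deg G x" "0 < n"
  shows "inv_deg x \<le> 1 / real n"
  using assms unfolding inv_deg_def by (intro divide_left_mono) auto

lemma inv_deg_le_half: "x \<in> pverts G \<Longrightarrow> inv_deg x \<le> 1 / 2"
  using inv_deg_le[of 2 x] deg_ge_2 by simp

lemma Gamma2_op_inv_deg:
  assumes x: "x \<in> pverts G"
  shows "4 * real (deg G x) * Gamma2_op G f f x =
    (\<Sum>y\<in>nbs G x. inv_deg y * (\<Sum>z\<in>nbs G y. (f z - f x - 2 * (f y - f x))\<^sup>2) - 2 * (f y - f x)\<^sup>2)
    + 2 * inv_deg x * (\<Sum>y\<in>nbs G x. f y - f x)\<^sup>2"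
proof -
  have "deg G y \<noteq> 0" if "y \<in> pverts G" for y using deg_ge_2[OF that] by simp
  then show ?thesis
    using Gamma2_op_eq[of G x f] x nbs_in_verts by (simp add: inv_deg_def)
qed

lemma Gamma2_op_nonneg_iff:
  assumes x: "x \<in> pverts G"
  shows "0 \<le> Gamma2_op G f f x \<longleftrightarrow>
    0 \<le> (\<Sum>y\<in>nbs G x. inv_deg y * (\<Sum>z\<in>nbs G y. (f z - f x - 2 * (f y - f x))\<^sup>2) - 2 * (f y - f x)\<^sup>2)
    + 2 * inv_deg x * (\<Sum>y\<in>nbs G x. f y - f x)\<^sup>2"
proof -
  have "0 < 4 * real (deg G x)" using deg_ge_2[OF x] by simp
  then show ?thesis
    unfolding Gamma2_op_inv_deg[OF x, symmetric] by (simp only: zero_le_mult_iff) auto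
qed

text \<open>Since the graph is \<open>C\<^sub>4\<close>-free, a vertex at distance two from \<open>x\<close> sees a single neighbour \<open>y\<close> of
  \<open>x\<close>, and giving it the value \<open>2 * f y\<close> makes its contribution to \<open>\<Gamma>\<^sub>2\<close> vanish.\<close>

lemma CD_imp_quadratic_form_nonneg:
  fixes \<phi> :: "'a \<Rightarrow> real"
  assumes CD: "CD_0_infinity G" and x: "x \<in> pverts G" and S: "S \<subseteq> nbs G x"
    and closed: "\<And>y. y \<in> S \<Longrightarrow> nbs G y \<inter> nbs G x \<subseteq> S"
  shows "0 \<le> (\<Sum>y\<in>S. inv_deg y * (4 * (\<phi> y)\<^sup>2 + (\<Sum>z\<in>nbs G y \<inter> nbs G x. (\<phi> z - 2 * \<phi> y)\<^sup>2))
      - 2 * (\<phi> y)\<^sup>2) + 2 * inv_deg x * (\<Sum>y\<in>S. \<phi> y)\<^sup>2"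
proof -
  \<comment> \<open>Extension of \<open>\<phi>\<close> by zero. As \<open>S\<close> is closed under
    adjacency inside \<open>nbs G x\<close>, no edge joins \<open>S\<close> to the other neighbours
    of \<open>x\<close>, so the summands outside \<open>S\<close> vanish and those inside keep their
    values.\<close>
  define \<psi> where "\<psi> y = (if y \<in> S then \<phi> y else 0)" for y
  define f where "f z = (if z = x then 0 else if z \<in> nbs G x then \<psi> z
    else 2 * \<psi> (THE y. y \<in> nbs G x \<and> z \<in> nbs G y))" for z
  have fx: "f x = 0" and fy: "\<And>y. y \<in> nbs G x \<Longrightarrow> f y = \<psi> y"
    using nbs_neq by (auto simp: f_def)
  have fz: "f z = 2 * \<psi> y" if "y \<in> nbs G x" "z \<in> nbs G y" "z \<noteq> x" "z \<notin> nbs G x" for y z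
  proof -
    have "(THE y. y \<in> nbs G x \<and> z \<in> nbs G y) = y"
      using that common_nb_unique[of x z] nbs_sym by (intro the_equality) blast+
    then show ?thesis using that by (simp add: f_def)
  qed
  have inner: "(\<Sum>z\<in>nbs G y. (f z - f x - 2 * (f y - f x))\<^sup>2) =
      4 * (\<psi> y)\<^sup>2 + (\<Sum>z\<in>nbs G y \<inter> nbs G x. (\<psi> z - 2 * \<psi> y)\<^sup>2)" if y: "y \<in> nbs G x" for y
  proof -
    have fin: "finite (nbs G y)" using finite_nbs nbs_in_verts y by blast
    have "(\<Sum>z\<in>nbs G y. (f z - f x - 2 * (f y - f x))\<^sup>2) =
        (\<Sum>z\<in>insert x (nbs G y \<inter> nbs G x). (f z - 2 * \<psi> y)\<^sup>2)"
      using nbs_sym[OF y] y fin fz by (intro sum.mono_neutral_cong_right) (auto simp: fx fy)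
    also have "\<dots> = 4 * (\<psi> y)\<^sup>2 + (\<Sum>z\<in>nbs G y \<inter> nbs G x. (f z - 2 * \<psi> y)\<^sup>2)"
      using fin nbs_neq[of x x] by (subst sum.insert) (auto simp: fx)
    also have "(\<Sum>z\<in>nbs G y \<inter> nbs G x. (f z - 2 * \<psi> y)\<^sup>2) =
        (\<Sum>z\<in>nbs G y \<inter> nbs G x. (\<psi> z - 2 * \<psi> y)\<^sup>2)"
      by (intro sum.cong refl) (auto simp: fy)
    finally show ?thesis .
  qed
  have "0 \<le> (\<Sum>y\<in>nbs G x. inv_deg y * (\<Sum>z\<in>nbs G y. (f z - f x - 2 * (f y - f x))\<^sup>2) - 2 * (f y - f x)\<^sup>2)
    + 2 * inv_deg x * (\<Sum>y\<in>nbs G x. f y - f x)\<^sup>2"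
    using CD x Gamma2_op_nonneg_iff[OF x] by (simp add: CD_0_infinity_def)
  also have "(\<Sum>y\<in>nbs G x. f y - f x) = (\<Sum>y\<in>S. \<phi> y)"
    using S finite_nbs[OF x] by (intro sum.mono_neutral_cong_right) (auto simp: fx fy \<psi>_def)
  also have "(\<Sum>y\<in>nbs G x. inv_deg y * (\<Sum>z\<in>nbs G y. (f z - f x - 2 * (f y - f x))\<^sup>2) - 2 * (f y - f x)\<^sup>2)
    = (\<Sum>y\<in>nbs G x. inv_deg y * (4 * (\<psi> y)\<^sup>2 + (\<Sum>z\<in>nbs G y \<inter> nbs G x. (\<psi> z - 2 * \<psi> y)\<^sup>2))
      - 2 * (\<psi> y)\<^sup>2)"
    by (intro sum.cong refl) (simp only: inner, simp add: fx fy)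
  also have "\<dots> = (\<Sum>y\<in>S. inv_deg y * (4 * (\<phi> y)\<^sup>2 + (\<Sum>z\<in>nbs G y \<inter> nbs G x. (\<phi> z - 2 * \<phi> y)\<^sup>2))
      - 2 * (\<phi> y)\<^sup>2)"
  proof (intro sum.mono_neutral_cong_right finite_nbs x S ballI)
    fix y assume y: "y \<in> nbs G x - S"
    have "(\<Sum>z\<in>nbs G y \<inter> nbs G x. (\<psi> z - 2 * \<psi> y)\<^sup>2) = 0"
      using y closed nbs_sym by (intro sum.neutral) (auto simp: \<psi>_def)
    with y show "inv_deg y * (4 * (\<psi> y)\<^sup>2 + (\<Sum>z\<in>nbs G y \<inter> nbs G x. (\<psi> z - 2 * \<psi> y)\<^sup>2))
      - 2 * (\<psi> y)\<^sup>2 = 0"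
      by (simp add: \<psi>_def)
  next
    fix y assume y: "y \<in> S"
    have "(\<Sum>z\<in>nbs G y \<inter> nbs G x. (\<psi> z - 2 * \<psi> y)\<^sup>2) = (\<Sum>z\<in>nbs G y \<inter> nbs G x. (\<phi> z - 2 * \<phi> y)\<^sup>2)"
      using closed[OF y] y by (intro sum.cong refl) (auto simp: \<psi>_def)
    with y show "inv_deg y * (4 * (\<psi> y)\<^sup>2 + (\<Sum>z\<in>nbs G y \<inter> nbs G x. (\<psi> z - 2 * \<psi> y)\<^sup>2)) - 2 * (\<psi> y)\<^sup>2
      = inv_deg y * (4 * (\<phi> y)\<^sup>2 + (\<Sum>z\<in>nbs G y \<inter> nbs G x. (\<phi> z - 2 * \<phi> y)\<^sup>2)) - 2 * (\<phi> y)\<^sup>2"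
      by (simp add: \<psi>_def)
  qed
  finally show ?thesis .
qed

section \<open>Vertices of degree at least 3\<close>

text \<open>An edge lies in at most one triangle. Equivalently, the neighbours of \<open>x\<close>
  induce a matching, and here \<open>m\<close> is the partner of \<open>y\<close>.\<close>

lemma common_nbs_eq:
  assumes "y \<in> nbs G x" "m \<in> nbs G y" "m \<in> nbs G x"
  shows "nbs G y \<inter> nbs G x = {m}"
  using assms common_nb_unique[of x y m] nbs_neq by blast

text \<open>The form is tested at \<open>y\<close>, not at \<open>x\<close>: without a triangle on
  the edge, \<open>x\<close> is isolated among the neighbours of \<open>y\<close>. Another neighbour
  \<open>z\<close> of \<open>y\<close> is added, together with its partner if it has one. Test
  vectors of sum zero remove the last term of the form.\<close>

lemma triangle_free_edge_deg:
  assumes CD: "CD_0_infinity G" and y: "y \<in> nbs G x" and free: "nbs G x \<inter> nbs G y = {}"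
  shows "deg G x \<le> 2"
proof (rule ccontr)
  assume "\<not> deg G x \<le> 2"
  then have dx: "inv_deg x \<le> 1 / 3" using inv_deg_le[of 3 x] by simp
  have yV: "y \<in> pverts G" and xy: "x \<in> nbs G y" using y nbs_in_verts nbs_sym by blast+
  have "\<not> nbs G y \<subseteq> {x}"
    using deg_ge_2[OF yV] card_mono[of "{x}" "nbs G y"] by auto
  then obtain z where z: "z \<in> nbs G y" "z \<noteq> x" by blast
  have dz: "inv_deg z \<le> 1 / 2" using z nbs_in_verts inv_deg_le_half by blast
  show False
  proof (cases "nbs G z \<inter> nbs G y = {}")
    case True
    \<comment> \<open>The value is \<open>4 * inv_deg x + 4 * inv_deg z - 4\<close>, at most
      -2/3.\<close>
    then show False
      using CD_imp_quadratic_form_nonneg[OF CD yV, of "{x, z}" "\<lambda>v. if v = x then 1 else -1"]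
        z xy free dx dz by auto
  next
    case False
    then obtain m where m: "m \<in> nbs G z" "m \<in> nbs G y" by blast
    have mz: "nbs G z \<inter> nbs G y = {m}" "nbs G m \<inter> nbs G y = {z}"
      using common_nbs_eq m z nbs_sym by blast+
    have ne: "m \<noteq> x" "m \<noteq> z" using m free z nbs_sym nbs_neq by blast+
    have dm: "inv_deg m \<le> 1 / 2" using m nbs_in_verts inv_deg_le_half by blast
    \<comment> \<open>The weight -2 at \<open>x\<close> balances the weights 1 at \<open>z\<close>
      and \<open>m\<close>. The value is
      \<open>16 * inv_deg x + 5 * inv_deg z + 5 * inv_deg m - 12\<close>, at most -5/3.\<close>
    show False
      using CD_imp_quadratic_form_nonneg[OF CD yV, of "{x, z, m}" "\<lambda>v. if v = x then -2 else 1"]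
        z m xy free mz ne dx dz dm by auto
  qed
qed

lemma deg_ge_3_in_triangle:
  assumes CD: "CD_0_infinity G" and "3 \<le> deg G x" and y: "y \<in> nbs G x"
  obtains m where "m \<in> nbs G x" "m \<in> nbs G y"
  using triangle_free_edge_deg[OF CD y] assms(2) by auto

text \<open>The matching on the neighbours of \<open>x\<close> pairs \<open>y\<close> with
  \<open>m\<close>, so a third neighbour \<open>p\<close> has its partner outside
  \<open>{y, m}\<close>.\<close>

lemma deg_ge_3_other_triangle:
  assumes CD: "CD_0_infinity G" and d: "3 \<le> deg G x" and y: "y \<in> nbs G x" "m \<in> nbs G x" "m \<in> nbs G y"
  obtains p q where "p \<in> nbs G x" "q \<in> nbs G x" "q \<in> nbs G p" "p \<noteq> q" "{p, q} \<inter> {y, m} = {}"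
proof -
  have "\<not> nbs G x \<subseteq> {y, m}"
    using d card_mono[of "{y, m}" "nbs G x"] card_insert_le_m1[of 2 "{m}" y] by auto
  then obtain p where p: "p \<in> nbs G x" "p \<noteq> y" "p \<noteq> m" by blast
  obtain q where q: "q \<in> nbs G x" "q \<in> nbs G p"
    using deg_ge_3_in_triangle[OF CD d p(1)] by blast
  have "nbs G y \<inter> nbs G x = {m}" "nbs G m \<inter> nbs G x = {y}"
    using common_nbs_eq y nbs_sym by blast+
  then have "q \<noteq> y" "q \<noteq> m" using p q nbs_sym by blast+
  then show thesis using that[OF p(1) q] p q nbs_neq by blast
qed

text \<open>Two triangles that share only \<open>x\<close> provide four neighbours. The gain from
  1/3 to 1/4 in the bound on \<open>inv_deg\<close> is what makes the next test vector
  conclusive.\<close>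

lemma deg_ge_3_imp_4:
  assumes CD: "CD_0_infinity G" and d: "3 \<le> deg G x" and x: "x \<in> pverts G"
  shows "4 \<le> deg G x"
proof -
  obtain y where y: "y \<in> nbs G x" using d by fastforce
  obtain m where m: "m \<in> nbs G x" "m \<in> nbs G y" using deg_ge_3_in_triangle[OF CD d y] .
  obtain p q where pq: "p \<in> nbs G x" "q \<in> nbs G x" "p \<noteq> q" "{p, q} \<inter> {y, m} = {}"
    using deg_ge_3_other_triangle[OF CD d y m] .
  have "card {y, m, p, q} = 4" using pq nbs_neq[OF m(2)] by auto
  moreover have "card {y, m, p, q} \<le> deg G x"
    using y m pq by (intro card_mono finite_nbs x) auto
  ultimately show ?thesis by simp
qed

text \<open>If \<open>y\<close> also had degree at least 3, it would lie on the triangle through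
  \<open>x\<close> and \<open>m\<close> and on a second one through \<open>p\<close> and
  \<open>q\<close>. The form at \<open>y\<close> is tested on these two matched pairs.\<close>

lemma deg_ge_3_nbs_deg_2:
  assumes CD: "CD_0_infinity G" and d: "3 \<le> deg G x" and y: "y \<in> nbs G x"
  shows "deg G y = 2"
proof (rule ccontr)
  have xV: "x \<in> pverts G" and yV: "y \<in> pverts G" and xy: "x \<in> nbs G y"
    using y nbs_in_verts nbs_sym by blast+
  assume "deg G y \<noteq> 2"
  then have dy: "3 \<le> deg G y" using deg_ge_2[OF yV] by simp
  have dx: "inv_deg x \<le> 1 / 4" "inv_deg y \<le> 1 / 4"
    using inv_deg_le[of 4] deg_ge_3_imp_4[OF CD d xV] deg_ge_3_imp_4[OF CD dy yV] by auto
  obtain m where m: "m \<in> nbs G y" "m \<in> nbs G x" using deg_ge_3_in_triangle[OF CD dy xy] .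
  obtain p q where pq: "p \<in> nbs G y" "q \<in> nbs G y" "q \<in> nbs G p" "p \<noteq> q" "{p, q} \<inter> {x, m} = {}"
    using deg_ge_3_other_triangle[OF CD dy xy m] .
  have common: "nbs G x \<inter> nbs G y = {m}" "nbs G m \<inter> nbs G y = {x}"
      "nbs G p \<inter> nbs G y = {q}" "nbs G q \<inter> nbs G y = {p}"
    using common_nbs_eq m pq xy nbs_sym by blast+
  have half: "inv_deg m \<le> 1 / 2" "inv_deg p \<le> 1 / 2" "inv_deg q \<le> 1 / 2"
    using inv_deg_le_half nbs_in_verts m pq by blast+
  \<comment> \<open>The ratio 2 to 1 makes the square that \<open>m\<close> contributes for its
    partner \<open>x\<close> vanish. The values -1 bring the total sum down to 1. The resulting
    bound is 25/4 + 2 + 5 + 1/2 - 14 = -1/4.\<close>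
  let ?\<phi> = "\<lambda>v. if v = x then 2 else if v = m then 1 else - 1 :: real"
  have "0 \<le> (\<Sum>v\<in>{x, m, p, q}. inv_deg v * (4 * (?\<phi> v)\<^sup>2
      + (\<Sum>z\<in>nbs G v \<inter> nbs G y. (?\<phi> z - 2 * ?\<phi> v)\<^sup>2)) - 2 * (?\<phi> v)\<^sup>2)
      + 2 * inv_deg y * (\<Sum>v\<in>{x, m, p, q}. ?\<phi> v)\<^sup>2"
    using CD_imp_quadratic_form_nonneg[OF CD yV, of "{x, m, p, q}" ?\<phi>] xy m pq common by auto
  also have "\<dots> = 25 * inv_deg x + 4 * inv_deg m + 5 * inv_deg p + 5 * inv_deg q + 2 * inv_deg y - 14"
    using pq nbs_neq[OF m(2)] by (auto simp: common)
  finally show False using dx half by linarith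
qed

end

section \<open>Friendship graphs: pairing, curvature and isomorphism\<close>

text \<open>A fixed-point-free involution splits \<open>S\<close> into two-element orbits, which the
  induction removes one at a time. It serves to number the triangles of a friendship graph, the
  Boolean telling the two leaves of a triangle apart.\<close>

lemma involution_enumeration:
  assumes "finite S" and "\<And>x. x \<in> S \<Longrightarrow> m x \<in> S"
    and "\<And>x. x \<in> S \<Longrightarrow> m (m x) = x" and "\<And>x. x \<in> S \<Longrightarrow> m x \<noteq> x"
  shows "\<exists>k h. bij_betw h ({..<k::nat} \<times> (UNIV::bool set)) S \<and> (\<forall>i<k. \<forall>b. h (i, \<not> b) = m (h (i, b)))"
  using assms
proof (induction S rule: finite_psubset_induct)
  case (psubset S)
  show ?case
  proof (cases "S = {}")
    case True
    then show ?thesis by (intro exI[of _ 0]) (auto simp: bij_betw_def)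
  next
    case False
    then obtain x where x: "x \<in> S" by blast
    let ?S = "S - {x, m x}"
    have closed: "m y \<in> ?S" if "y \<in> ?S" for y
    proof -
      have y: "y \<in> S" "y \<noteq> x" "y \<noteq> m x" using that by auto
      have "m y \<noteq> x" "m y \<noteq> m x"
        using psubset.prems(2)[OF y(1)] psubset.prems(2)[OF x] y(2,3) by auto
      then show ?thesis using psubset.prems(1)[OF y(1)] by blast
    qed
    have "\<exists>k h. bij_betw h ({..<k::nat} \<times> (UNIV::bool set)) ?S \<and>
        (\<forall>i<k. \<forall>b. h (i, \<not> b) = m (h (i, b)))"
    proof (rule psubset.IH)
      show "?S \<subset> S" using x by blast
    qed (use closed psubset.prems in auto)
    then obtain k h where h: "bij_betw h ({..<k::nat} \<times> UNIV) ?S"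
      and hm: "\<forall>i<k. \<forall>b::bool. h (i, \<not> b) = m (h (i, b))"
      by blast
    define h' where "h' = (\<lambda>(i, b). if i < k then h (i, b) else if b then x else m x)"
    have "bij_betw h' ({..<k} \<times> UNIV) ?S"
      using h by (rule bij_betw_cong[THEN iffD1, rotated]) (auto simp: h'_def)
    moreover have "bij_betw h' ({k} \<times> UNIV) {x, m x}"
      using psubset.prems(3)[OF x] by (auto simp: bij_betw_def inj_on_def h'_def UNIV_bool)
    ultimately have "bij_betw h' ({..<k} \<times> UNIV \<union> {k} \<times> UNIV) (?S \<union> {x, m x})"
      by (rule bij_betw_combine) auto
    moreover have "{..<k} \<times> UNIV \<union> {k} \<times> UNIV = {..<Suc k} \<times> (UNIV :: bool set)" by auto
    moreover have "?S \<union> {x, m x} = S" using x psubset.prems(1) by auto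
    moreover have "\<forall>i<Suc k. \<forall>b. h' (i, \<not> b) = m (h' (i, b))"
      using hm psubset.prems(2)[OF x] by (auto simp: h'_def less_Suc_eq)
    ultimately show ?thesis by (intro exI[of _ "Suc k"] exI[of _ h']) simp
  qed
qed

context c4_free_graph
begin

text \<open>The summand \<open>z = x\<close> is \<open>4 * (f y - f x)\<^sup>2\<close>, and the
  weight 1/2 turns it into exactly the subtracted term. The degree of \<open>x\<close> is arbitrary,
  so this covers 2-regular graphs as well as the centre of a friendship graph.\<close>

lemma Gamma2_nonneg_if_nbs_deg_2:
  assumes x: "x \<in> pverts G" and two: "\<And>y. y \<in> nbs G x \<Longrightarrow> deg G y = 2"
  shows "0 \<le> Gamma2_op G f f x"
proof -
  have "0 \<le> inv_deg y * (\<Sum>z\<in>nbs G y. (f z - f x - 2 * (f y - f x))\<^sup>2) - 2 * (f y - f x)\<^sup>2"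
    if y: "y \<in> nbs G x" for y
  proof -
    have "finite (nbs G y)" using y nbs_in_verts finite_nbs by blast
    then have le: "(f x - f x - 2 * (f y - f x))\<^sup>2 \<le> (\<Sum>z\<in>nbs G y. (f z - f x - 2 * (f y - f x))\<^sup>2)"
      using nbs_sym[OF y] by (intro member_le_sum) auto
    have "(f x - f x - 2 * (f y - f x))\<^sup>2 = 4 * (f y - f x)\<^sup>2" by algebra
    moreover have iy: "inv_deg y = 1 / 2" using two[OF y] by (simp add: inv_deg_def)
    ultimately show ?thesis using le unfolding iy by linarith
  qed
  then show ?thesis
    unfolding Gamma2_op_nonneg_iff[OF x]
    by (intro add_nonneg_nonneg sum_nonneg mult_nonneg_nonneg inv_deg_nonneg) auto
qed

text \<open>An intrinsic description of the friendship graphs that needs no numbering of the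
  triangles. A triangle is included, with any of its vertices as \<open>c\<close>.\<close>

definition friendship_centre :: "'a \<Rightarrow> bool" where
  "friendship_centre c \<longleftrightarrow> c \<in> pverts G \<and> (\<forall>v\<in>pverts G. v \<noteq> c \<longrightarrow> v \<in> nbs G c \<and> deg G v = 2)"

lemma deg_2_nbs_eq:
  assumes "deg G x = 2" "y \<in> nbs G x"
  obtains z where "nbs G x = {y, z}" "z \<noteq> y"
  using assms by (auto simp: card_2_iff doubleton_eq_iff)

text \<open>The second neighbour \<open>y\<close> of \<open>x\<close> is itself adjacent to
  \<open>c\<close> and of degree 2, so \<open>c\<close> and \<open>x\<close> are all its
  neighbours.\<close>

lemma friendship_centre_triangle:
  assumes c: "friendship_centre c" and x: "x \<in> pverts G" "x \<noteq> c"
  obtains y where "nbs G x = {c, y}" "y \<noteq> c" "y \<noteq> x" "nbs G y = {c, x}" "y \<in> nbs G c" "x \<in> nbs G c"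
proof -
  have xc: "x \<in> nbs G c" and "deg G x = 2"
    using c x by (auto simp: friendship_centre_def)
  then obtain y where y: "nbs G x = {c, y}" "y \<noteq> c"
    using deg_2_nbs_eq nbs_sym by metis
  then have xy: "x \<in> nbs G y" and yV: "y \<in> pverts G" and ne: "y \<noteq> x"
    using nbs_sym[of y x] nbs_in_verts[of y x] nbs_neq[of y x] by auto
  have yc: "y \<in> nbs G c" "deg G y = 2"
    using c yV y(2) by (auto simp: friendship_centre_def)
  have "nbs G y = {c, x}"
    using deg_2_nbs_eq[OF yc(2) xy] nbs_sym[OF yc(1)] x(2) by (metis doubleton_eq_iff insertE singletonD)
  then show thesis using that[OF y ne _ yc(1) xc] by blast
qed

lemma inv_deg_friendship_leaf: "friendship_centre c \<Longrightarrow> x \<in> nbs G c \<Longrightarrow> inv_deg x = 1 / 2"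
  using nbs_neq nbs_in_verts by (auto simp: inv_deg_def friendship_centre_def)

text \<open>Only leaves need work. There all terms at distance two are dropped, which leaves a
  binary form in the increments \<open>u\<close> and \<open>v\<close> towards the partner and the
  centre. The bound 14 suffices because the centre of a friendship graph has even degree.\<close>

lemma friendship_imp_CD:
  assumes c: "friendship_centre c" and d: "deg G c \<le> 14"
  shows "CD_0_infinity G"
  unfolding CD_0_infinity_def
proof (intro allI ballI)
  fix f x assume x: "x \<in> pverts G"
  show "0 \<le> Gamma2_op G f f x"
  proof (cases "x = c")
    case True
    then show ?thesis
      using c x nbs_neq nbs_in_verts
      by (intro Gamma2_nonneg_if_nbs_deg_2) (auto simp: friendship_centre_def)
  next
    case False
    obtain y where y: "nbs G x = {c, y}" "y \<noteq> c" "y \<noteq> x" "nbs G y = {c, x}" "y \<in> nbs G c" "x \<in> nbs G c"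
      using friendship_centre_triangle[OF c x False] .
    define u v where "u = f y - f x" and "v = f c - f x"
    have cV: "c \<in> pverts G" using c by (simp add: friendship_centre_def)
    let ?T = "\<Sum>z\<in>nbs G c. (f z - f x - 2 * (f c - f x))\<^sup>2"
    have "(\<Sum>z\<in>{x, y}. (f z - f x - 2 * (f c - f x))\<^sup>2) \<le> ?T"
      using y finite_nbs[OF cV] by (intro sum_mono2) auto
    then have T: "4 * v\<^sup>2 + (u - 2 * v)\<^sup>2 \<le> ?T"
      using y(3) by (auto simp: u_def v_def power2_eq_square algebra_simps)
    have "1 / 14 \<le> inv_deg c"
      using d deg_ge_2[OF cV] unfolding inv_deg_def by (intro divide_left_mono) auto
    then have "1 / 14 * (4 * v\<^sup>2 + (u - 2 * v)\<^sup>2) \<le> inv_deg c * ?T"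
      using T by (intro mult_mono) auto
    \<comment> \<open>The binary form for centre degree 14, written as a sum of squares.\<close>
    moreover have "0 \<le> (39 * u\<^sup>2 + (2 * u - v)\<^sup>2) / 14" by simp
    moreover have "(39 * u\<^sup>2 + (2 * u - v)\<^sup>2) / 14 = 1 / 14 * (4 * v\<^sup>2 + (u - 2 * v)\<^sup>2) - 2 * v\<^sup>2
       + 1 / 2 * ((v - 2 * u)\<^sup>2 + 4 * u\<^sup>2) - 2 * u\<^sup>2 + (u + v)\<^sup>2"
      by (simp add: power2_eq_square field_simps)
    moreover have "(\<Sum>w\<in>nbs G x. inv_deg w * (\<Sum>z\<in>nbs G w. (f z - f x - 2 * (f w - f x))\<^sup>2)
        - 2 * (f w - f x)\<^sup>2) + 2 * inv_deg x * (\<Sum>w\<in>nbs G x. f w - f x)\<^sup>2 =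
      inv_deg c * ?T - 2 * v\<^sup>2 + (1 / 2 * ((v - 2 * u)\<^sup>2 + 4 * u\<^sup>2) - 2 * u\<^sup>2) + (u + v)\<^sup>2"
    proof -
      have pair: "sum g {c, y} = g c + g y" for g :: "'a \<Rightarrow> real" using y(2) by simp
      have inner: "(\<Sum>z\<in>nbs G y. (f z - f x - 2 * (f y - f x))\<^sup>2) = (v - 2 * u)\<^sup>2 + 4 * u\<^sup>2"
        using False y(4) by (auto simp: u_def v_def power2_eq_square algebra_simps)
      have half: "inv_deg x = 1 / 2" "inv_deg y = 1 / 2"
        using inv_deg_friendship_leaf[OF c] y by auto
      show ?thesis
        unfolding y(1) pair inner half by (simp add: u_def v_def add.commute)
    qed
    ultimately show ?thesis
      unfolding Gamma2_op_nonneg_iff[OF x] by linarith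
  qed
qed

text \<open>At a leaf, with the terms at distance two made zero and centre degree d, the form has
  \<open>v\<^sup>2\<close> coefficient 8/d - 1/2. For d = 16 this vanishes while the mixed
  coefficient -4/d does not, so the form is indefinite.\<close>

lemma CD_friendship_deg_le:
  assumes CD: "CD_0_infinity G" and c: "friendship_centre c"
  shows "deg G c \<le> 15"
proof (rule ccontr)
  assume "\<not> deg G c \<le> 15"
  then have b: "inv_deg c \<le> 1 / 16" using inv_deg_le[of 16 c] by simp
  have cV: "c \<in> pverts G" using c by (simp add: friendship_centre_def)
  obtain x where xc: "x \<in> nbs G c" using deg_ge_2[OF cV] by fastforce
  then have x: "x \<in> pverts G" "x \<noteq> c" using nbs_in_verts nbs_neq by blast+
  obtain y where y: "nbs G x = {c, y}" "y \<noteq> c" "y \<noteq> x" "nbs G y = {c, x}" "y \<in> nbs G c"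
    using friendship_centre_triangle[OF c x] .
  have common: "nbs G c \<inter> nbs G x = {y}" "nbs G y \<inter> nbs G x = {c}"
    using y nbs_neq[of c c] by auto
  have half: "inv_deg x = 1 / 2" "inv_deg y = 1 / 2"
    using inv_deg_friendship_leaf[OF c] y xc by auto
  \<comment> \<open>At degree 16 the form takes the value 49/16 t^2 - t/4 at weight 1 on the centre
    and t on the partner, which is negative for small positive t; t = 1/20 is one choice.\<close>
  let ?\<phi> = "\<lambda>v. if v = c then 1 else 1 / 20 :: real"
  have "0 \<le> (\<Sum>v\<in>{c, y}. inv_deg v * (4 * (?\<phi> v)\<^sup>2
      + (\<Sum>z\<in>nbs G v \<inter> nbs G x. (?\<phi> z - 2 * ?\<phi> v)\<^sup>2)) - 2 * (?\<phi> v)\<^sup>2)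
      + 2 * inv_deg x * (\<Sum>v\<in>{c, y}. ?\<phi> v)\<^sup>2"
    using CD_imp_quadratic_form_nonneg[OF CD x(1), of "{c, y}" ?\<phi>] y by auto
  also have "\<dots> = inv_deg c * (4 + (39 / 20)\<^sup>2) - 2 + 1 / 2 * (4 / 400 + (9 / 10)\<^sup>2) - 2 / 400 + (21 / 20)\<^sup>2"
    using y(2) by (simp add: common half power2_eq_square)
  finally show False using b by (simp add: power2_eq_square)
qed

text \<open>Each neighbour of \<open>c\<close> has degree 2 and lies on a triangle through
  \<open>c\<close>, so its neighbours stay in the closed neighbourhood of \<open>c\<close>. By
  connectedness that is the whole graph.\<close>

lemma CD_deg_ge_3_friendship_centre:
  assumes CD: "CD_0_infinity G" and cV: "c \<in> pverts G" and d: "3 \<le> deg G c"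
  shows "friendship_centre c"
proof -
  have "insert c (nbs G c) = pverts G"
  proof (rule verts_eqI)
    fix x assume "x \<in> insert c (nbs G c)"
    moreover have "nbs G x \<subseteq> insert c (nbs G c)" if x: "x \<in> nbs G c"
    proof -
      obtain m where m: "m \<in> nbs G c" "m \<in> nbs G x" using deg_ge_3_in_triangle[OF CD d x] .
      obtain z where "nbs G x = {c, z}"
        using deg_2_nbs_eq[OF deg_ge_3_nbs_deg_2[OF CD d x] nbs_sym[OF x]] .
      with m show ?thesis using nbs_neq[of m c] by auto
    qed
    ultimately show "nbs G x \<subseteq> insert c (nbs G c)" by auto
  qed (use cV nbs_in_verts in auto)
  then show ?thesis
    using cV deg_ge_3_nbs_deg_2[OF CD d] by (auto simp: friendship_centre_def)
qed

text \<open>Mapping a leaf to the other leaf of its triangle is a fixed-point-free involution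
  \<open>m\<close>. Numbering its orbits labels the leaves by pairs \<open>(i, b)\<close> and shows
  that the degree of \<open>c\<close> is even.\<close>

lemma friendship_centre_iso:
  assumes c: "friendship_centre c"
  shows "\<exists>k\<ge>1. deg G c = 2 * k \<and> digraph_iso (with_proj G) (with_proj (friendship_graph k))"
proof -
  have cV: "c \<in> pverts G" and V: "pverts G = insert c (nbs G c)"
    using c nbs_in_verts by (auto simp: friendship_centre_def)
  have "\<exists>y. nbs G x = {c, y} \<and> y \<in> nbs G c \<and> y \<noteq> x \<and> nbs G y = {c, x}" if "x \<in> nbs G c" for x
    using friendship_centre_triangle[OF c, of x] that nbs_in_verts nbs_neq by metis
  then obtain m where m: "\<And>x. x \<in> nbs G c \<Longrightarrow>
      nbs G x = {c, m x} \<and> m x \<in> nbs G c \<and> m x \<noteq> x \<and> nbs G (m x) = {c, x}"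
    by metis
  have "m (m x) = x" if "x \<in> nbs G c" for x
    using m[OF that] m[of "m x"] nbs_neq[of x c] that by (auto simp: doubleton_eq_iff)
  then obtain k h where h: "bij_betw h ({..<k::nat} \<times> (UNIV::bool set)) (nbs G c)"
    and hm: "\<And>i b. i < k \<Longrightarrow> h (i, \<not> b) = m (h (i, b))"
    using involution_enumeration[OF finite_nbs[OF cV], of m] m by blast
  have "deg G c = card ({..<k} \<times> (UNIV::bool set))"
    using bij_betw_same_card[OF h] by simp
  then have d: "deg G c = 2 * k" by (simp add: card_cartesian_product)
  then have k: "1 \<le> k" using deg_ge_2[OF cV] by simp
  let ?F = "friendship_graph k"
  have VF: "pverts ?F = insert None (Some ` ({..<k} \<times> UNIV))"
    using k by (intro pverts_friendship_graph) simp
  define g where "g v = (case v of None \<Rightarrow> c | Some p \<Rightarrow> h p)" for v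
  have hc: "h p \<in> nbs G c" if "p \<in> {..<k} \<times> UNIV" for p
    using bij_betwE[OF h] that by blast
  have inj: "inj_on h ({..<k} \<times> UNIV)" using h by (simp add: bij_betw_def)
  have "bij_betw (\<lambda>p. g (Some p)) ({..<k} \<times> UNIV) (nbs G c)"
    using h by (simp add: g_def)
  then have "bij_betw g (Some ` ({..<k} \<times> UNIV)) (nbs G c)"
    by (auto simp: bij_betw_def inj_on_def image_image)
  moreover have "bij_betw g {None} {c}" by (simp add: bij_betw_def g_def)
  ultimately have bij: "bij_betw g (pverts ?F) (pverts G)"
    unfolding VF V using bij_betw_combine[of g "{None}" "{c}"] nbs_neq[of c c] by fastforce
  have arc: "(u, v) \<in> parcs ?F \<longleftrightarrow> (g u, g v) \<in> parcs G"
    if u: "u \<in> pverts ?F" and v: "v \<in> pverts ?F" for u v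
  proof (cases u)
    case None
    show ?thesis
    proof (cases v)
      case None
      then show ?thesis using \<open>u = None\<close> nbs_neq[of c c]
        by (auto simp: g_def nbs_def friendship_graph_def)
    next
      case (Some q)
      then show ?thesis using \<open>u = None\<close> v hc[of q] unfolding VF
        by (auto simp: g_def nbs_def friendship_graph_def friendship_triangle_def)
    qed
  next
    case (Some p)
    then obtain i b where p: "u = Some (i, b)" "i < k" using u unfolding VF by auto
    \<comment> \<open>Both graphs have explicit two-element neighbourhoods at a leaf, and
      \<open>g\<close> matches them since flipping \<open>b\<close> corresponds to applying
      \<open>m\<close>.\<close>
    have "(u, v) \<in> parcs ?F \<longleftrightarrow> v \<in> {None, Some (i, \<not> b)}"
      using nbs_friendship_graph_Some[OF p(2), of b] p(1) by (auto simp: nbs_def)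
    also have "\<dots> \<longleftrightarrow> g v \<in> {g None, g (Some (i, \<not> b))}"
    proof -
      have "inj_on g (pverts ?F)" "None \<in> pverts ?F" "Some (i, \<not> b) \<in> pverts ?F"
        using bij p VF by (auto simp: bij_betw_def)
      then show ?thesis using v by (auto simp: inj_on_eq_iff)
    qed
    also have "\<dots> \<longleftrightarrow> g v \<in> nbs G (g u)"
      using m[OF hc[of "(i, b)"]] p hm by (simp add: g_def)
    finally show ?thesis by (simp add: nbs_def)
  qed
  have "digraph_iso (with_proj ?F) (with_proj G)"
    using digraph_iso_with_proj_iff[OF pair_wf_friendship_graph, of G] bij arc
      wf_digraph wf_digraph_wp_iff by blast
  then have "digraph_iso (with_proj G) (with_proj ?F)"
    by (rule digraph_iso_swap[rotated]) (simp add: wf_digraph_wp_iff pair_wf_friendship_graph)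
  then show ?thesis using k d by blast
qed

lemma iso_friendship_centre:
  assumes k: "1 \<le> k" and iso: "digraph_iso (with_proj G) (with_proj (friendship_graph k))"
  shows "\<exists>c. friendship_centre c \<and> deg G c = 2 * k"
proof -
  let ?F = "friendship_graph k"
  have wf: "pair_wf_digraph G" using wf_digraph wf_digraph_wp_iff by blast
  obtain f where f: "bij_betw f (pverts G) (pverts ?F)"
    and arc: "\<forall>u\<in>pverts G. \<forall>v\<in>pverts G. (u, v) \<in> parcs G \<longleftrightarrow> (f u, f v) \<in> parcs ?F"
    using iso digraph_iso_with_proj_iff[OF wf pair_wf_friendship_graph] by blast
  note degf = deg_bij_betw[OF wf pair_wf_friendship_graph f arc]
  have VF: "pverts ?F = insert None (Some ` ({..<k} \<times> UNIV))"
    using k by (intro pverts_friendship_graph) simp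
  then obtain c where c: "c \<in> pverts G" "f c = None"
    using f by (metis bij_betw_def imageE insertI1)
  have "v \<in> nbs G c \<and> deg G v = 2" if v: "v \<in> pverts G" "v \<noteq> c" for v
  proof -
    have "f v \<noteq> None" using f v c by (metis bij_betw_def inj_onD)
    then obtain i b where fv: "f v = Some (i, b)" "i < k"
      using bij_betwE[OF f] v VF by fastforce
    have "None \<in> nbs ?F (f v)" and "deg ?F (f v) = 2"
      using nbs_friendship_graph_Some[OF fv(2), of b] fv by auto
    then show ?thesis
      using degf[OF v(1)] arc c v nbs_sym[of c v] by (auto simp: nbs_def)
  qed
  then have "friendship_centre c" using c by (simp add: friendship_centre_def)
  moreover have "deg G c = 2 * k"
    using degf[OF c(1)] c(2) deg_friendship_graph_None by metis
  ultimately show ?thesis by blast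
qed

section \<open>Two-regular graphs: cycles and the line\<close>

lemma iso_two_regular_imp_CD:
  assumes H: "pair_wf_digraph H" and iso: "digraph_iso (with_proj G) (with_proj H)"
    and two: "\<And>v. v \<in> pverts H \<Longrightarrow> deg H v = 2"
  shows "CD_0_infinity G"
proof -
  have wf: "pair_wf_digraph G" using wf_digraph wf_digraph_wp_iff by blast
  obtain f where f: "bij_betw f (pverts G) (pverts H)"
    and arc: "\<forall>u\<in>pverts G. \<forall>v\<in>pverts G. (u, v) \<in> parcs G \<longleftrightarrow> (f u, f v) \<in> parcs H"
    using iso digraph_iso_with_proj_iff[OF wf H] by blast
  have "deg G v = 2" if "v \<in> pverts G" for v
    using deg_bij_betw[OF wf H f arc that] two bij_betwE[OF f] that by metis
  then show ?thesis
    unfolding CD_0_infinity_def using Gamma2_nonneg_if_nbs_deg_2 nbs_in_verts by blast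
qed

text \<open>A step without backtracking depends on the current vertex and its predecessor, so
  dependent choice runs over arcs instead of vertices.\<close>

lemma two_regular_ray:
  assumes two: "\<And>v. v \<in> pverts G \<Longrightarrow> deg G v = 2" and ab: "b \<in> nbs G a"
  obtains p :: "nat \<Rightarrow> 'a" where "p 0 = a" "p (Suc 0) = b"
    "\<And>n. p (Suc n) \<in> nbs G (p n)" "\<And>n. p (Suc (Suc n)) \<noteq> p n"
proof -
  have "\<exists>e. \<forall>n. (e n \<in> parcs G \<and> (n = 0 \<longrightarrow> e n = (a, b)))
      \<and> (fst (e (Suc n)) = snd (e n) \<and> snd (e (Suc n)) \<noteq> fst (e n))"
  proof (rule dependent_nat_choice)
    show "\<exists>e. e \<in> parcs G \<and> (0 = (0::nat) \<longrightarrow> e = (a, b))" using ab by (auto simp: nbs_def)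
  next
    fix e and n :: nat assume "e \<in> parcs G \<and> (n = 0 \<longrightarrow> e = (a, b))"
    then have e: "snd e \<in> nbs G (fst e)" by (simp add: nbs_def)
    obtain z where "nbs G (snd e) = {fst e, z}" "z \<noteq> fst e"
      using deg_2_nbs_eq[OF two[OF nbs_in_verts[OF e]] nbs_sym[OF e]] .
    then show "\<exists>e'. (e' \<in> parcs G \<and> (Suc n = 0 \<longrightarrow> e' = (a, b))) \<and>
        (fst e' = snd e \<and> snd e' \<noteq> fst e)"
      by (intro exI[of _ "(snd e, z)"]) (auto simp: nbs_def)
  qed
  then obtain e where e: "\<And>n. e n \<in> parcs G" "e 0 = (a, b)"
      "\<And>n. fst (e (Suc n)) = snd (e n)" "\<And>n. snd (e (Suc n)) \<noteq> fst (e n)"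
    by auto
  show thesis
  proof (rule that[of "\<lambda>n. fst (e n)"])
    show "fst (e (Suc n)) \<in> nbs G (fst (e n))" for n
      using e(1)[of n] by (simp add: nbs_def e(3))
  qed (use e in auto)
qed

text \<open>Two rays that traverse the same edge in opposite directions are glued to a two-sided
  walk. Its range contains all neighbours of its vertices, hence is everything.\<close>

lemma two_regular_walk:
  assumes two: "\<And>v. v \<in> pverts G \<Longrightarrow> deg G v = 2"
  obtains w :: "int \<Rightarrow> 'a" where "range w = pverts G"
    "\<And>i. nbs G (w i) = {w (i - 1), w (i + 1)}" "\<And>i. w (i + 1) \<noteq> w (i - 1)"
proof -
  obtain x where x: "x \<in> pverts G"
    using conn by (auto simp: connected_def strongly_connected_def)
  obtain y where y: "y \<in> nbs G x" using two[OF x] by fastforce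
  obtain p where p: "p 0 = x" "p (Suc 0) = y"
    "\<And>n. p (Suc n) \<in> nbs G (p n)" "\<And>n. p (Suc (Suc n)) \<noteq> p n"
    using two_regular_ray[OF two y] by blast
  obtain q where q: "q 0 = y" "q (Suc 0) = x"
    "\<And>n. q (Suc n) \<in> nbs G (q n)" "\<And>n. q (Suc (Suc n)) \<noteq> q n"
    using two_regular_ray[OF two nbs_sym[OF y]] by blast
  \<comment> \<open>The shift \<open>1 - i\<close> lets both formulas agree at 0 and 1. Overlapping
    in a whole edge, any three consecutive positions lie on a single ray, so no backtracking can
    occur at the seam.\<close>
  define w where "w i = (if 0 \<le> i then p (nat i) else q (nat (1 - i)))" for i
  have wp: "w i = p (nat i)" if "0 \<le> i" for i using that by (simp add: w_def)
  have wq: "w i = q (nat (1 - i))" if "i \<le> 1" for i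
  proof -
    have "i < 0 \<or> i = 0 \<or> i = 1" using that by linarith
    then show ?thesis using p(1,2) q(1,2) by (auto simp: w_def)
  qed
  have step: "w (i + 1) \<in> nbs G (w i) \<and> w (i + 2) \<noteq> w i" for i
  proof (cases "0 \<le> i")
    case True
    then have "nat (i + 1) = Suc (nat i)" "nat (i + 2) = Suc (Suc (nat i))" by auto
    then show ?thesis using True p(3,4) by (simp add: wp)
  next
    case False
    define k where "k = nat (1 - (i + 2))"
    have "nat (1 - i) = Suc (Suc k)" "nat (1 - (i + 1)) = Suc k"
      using False by (auto simp: k_def)
    then have "w i = q (Suc (Suc k))" "w (i + 1) = q (Suc k)" "w (i + 2) = q k"
      using False wq[of i] wq[of "i + 1"] wq[of "i + 2"] by (auto simp: k_def)
    then show ?thesis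
      using nbs_sym[OF q(3)[of "Suc k"]] q(4)[of k] by simp
  qed
  have wV: "w i \<in> pverts G" for i
    using step[of i] in_arcsD1 by (auto simp: nbs_def)
  have ne: "w (i + 1) \<noteq> w (i - 1)" for i
    using step[of "i - 1"] by (simp add: add.commute)
  have nb: "nbs G (w i) = {w (i - 1), w (i + 1)}" for i
  proof -
    have "w (i - 1) \<in> nbs G (w i)" using step[of "i - 1"] nbs_sym by auto
    then obtain z where "nbs G (w i) = {w (i - 1), z}" using deg_2_nbs_eq[OF two[OF wV]] by blast
    then show ?thesis using step[of i] ne[of i] by auto
  qed
  have "range w = pverts G"
    by (rule verts_eqI) (use wV nb in auto)
  then show thesis using that nb ne by blast
qed

text \<open>An injective walk gives the line. Otherwise the least distance \<open>n\<close> between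
  positions with equal values is a period and gives a cycle of length \<open>n\<close>. Length 4 is
  excluded, and length 3 is recorded as a friendship centre because a triangle is the smallest
  friendship graph.\<close>

lemma two_regular_classification:
  assumes two: "\<And>v. v \<in> pverts G \<Longrightarrow> deg G v = 2"
  shows "(\<exists>n\<ge>5. digraph_iso (with_proj G) (with_proj (cycle_graph n)))
    \<or> digraph_iso (with_proj G) (with_proj infinite_line) \<or> (\<exists>c. friendship_centre c)"
proof -
  obtain w :: "int \<Rightarrow> 'a" where V: "range w = pverts G"
    and nb: "\<And>i. nbs G (w i) = {w (i - 1), w (i + 1)}" and ne: "\<And>i. w (i + 1) \<noteq> w (i - 1)"
    using two_regular_walk[OF two] by blast
  have wf: "pair_wf_digraph G" using wf_digraph wf_digraph_wp_iff by blast
  show ?thesis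
  proof (cases "inj w")
    case True
    have "bij_betw w (pverts infinite_line) (pverts G)"
      using True V by (simp add: bij_betw_def infinite_line_def)
    moreover have "(i, j) \<in> parcs infinite_line \<longleftrightarrow> (w i, w j) \<in> parcs G" for i j
    proof -
      have "(w i, w j) \<in> parcs G \<longleftrightarrow> w j \<in> nbs G (w i)" by (simp add: nbs_def)
      also have "\<dots> \<longleftrightarrow> j = i - 1 \<or> j = i + 1" using True by (simp add: nb inj_eq)
      also have "\<dots> \<longleftrightarrow> \<bar>i - j\<bar> = 1" by auto
      finally show ?thesis by (simp add: infinite_line_def)
    qed
    ultimately have "digraph_iso (with_proj infinite_line) (with_proj G)"
      using digraph_iso_with_proj_iff[OF pair_wf_infinite_line wf] by blast
    then show ?thesis
      using digraph_iso_swap pair_wf_infinite_line wf_digraph_wp_iff by blast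
  next
    case False
    let ?P = "\<lambda>n::nat. 0 < n \<and> (\<exists>i. w i = w (i + int n))"
    obtain i j where "w i = w j" "i < j"
      using False by (metis injI linorder_neqE_linordered_idom)
    then have ex: "?P (nat (j - i))" by (auto intro!: exI[of _ i])
    \<comment> \<open>A single coincidence at distance \<open>n\<close> is required here; that
      \<open>n\<close> is a period everywhere is deduced from minimality.\<close>
    define n where "n = (LEAST n. ?P n)"
    have Pn: "?P n" unfolding n_def using ex by (rule LeastI)
    have min: "n \<le> k" if "?P k" for k unfolding n_def using that by (rule Least_le)
    \<comment> \<open>Distance 1 would be a loop, and distance 2 would be backtracking.\<close>
    have "\<not> ?P 1" using nb nbs_neq[of "w (i + 1)" "w i" for i] by (metis insertCI of_nat_1)
    moreover have "w (i + 2) \<noteq> w i" for i using ne[of "i + 1"] by (simp add: add.commute)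
    then have "\<not> ?P 2" by (metis of_nat_numeral)
    ultimately have "n \<noteq> 1" "n \<noteq> 2" using Pn by auto
    then have n3: "3 \<le> n" using Pn by linarith
    \<comment> \<open>Equal vertices have equal neighbour pairs. Matching them crosswise would give
      \<open>w (i + 1) = w (i + int n - 1)\<close>, a coincidence at the smaller positive distance
      \<open>n - 2\<close>, so the walk continues in the same direction and the coincidence spreads
      to both sides.\<close>
    have step: "w (i + 1) = w (i + 1 + int n) \<and> w (i - 1) = w (i - 1 + int n)"
      if "w i = w (i + int n)" for i
    proof -
      have "w (i + 1) \<noteq> w (i + 1 + int (n - 2))"
      proof
        assume "w (i + 1) = w (i + 1 + int (n - 2))"
        then have "n \<le> n - 2" using n3 by (intro min conjI exI[of _ "i + 1"]) auto
        then show False using n3 by simp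
      qed
      moreover have "i + 1 + int (n - 2) = i + int n - 1" using n3 by simp
      ultimately have "w (i + 1) \<noteq> w (i + int n - 1)" by simp
      moreover have "{w (i - 1), w (i + 1)} = {w (i + int n - 1), w (i + int n + 1)}"
        using nb[of i] nb[of "i + int n"] that by simp
      ultimately show ?thesis
        using ne[of i] by (auto simp: doubleton_eq_iff algebra_simps)
    qed
    obtain i0 where i0: "w i0 = w (i0 + int n)" using Pn by blast
    have period: "w i = w (i + int n)" for i
      by (induction i rule: int_induct[of _ i0]) (use i0 step in auto)
    have periods: "w (i + int n * int k) = w i" for i k
    proof (induction k)
      case (Suc k)
      then show ?case using period[of "i + int n * int k"] by (simp add: algebra_simps)
    qed simp
    have w_mod: "w i = w (i mod int n)" for i
    proof (cases "0 \<le> i div int n")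
      case True
      have "w (i mod int n + int n * int (nat (i div int n))) = w (i mod int n)" by (rule periods)
      then show ?thesis using True by simp
    next
      case False
      have "w (i + int n * int (nat (- (i div int n)))) = w i" by (rule periods)
      moreover have "i + int n * int (nat (- (i div int n))) = i mod int n"
        using False by (simp add: minus_mult_div_eq_mod)
      ultimately show ?thesis by simp
    qed
    have inj: "a = b" if ab: "a < n" "b < n" "w (int a) = w (int b)" for a b
    proof (rule ccontr)
      assume "a \<noteq> b"
      moreover have "\<not> c < d" if "c < n" "d < n" "w (int c) = w (int d)" for c d
      proof
        assume "c < d"
        then have "n \<le> d - c" using that by (intro min conjI exI[of _ "int c"]) auto
        then show False using that(2) \<open>c < d\<close> by simp
      qed
      ultimately show False using ab by (metis linorder_neqE_nat)
    qed
    have im: "w (int (nat (i mod int n))) = w i \<and> nat (i mod int n) < n" for i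
    proof -
      have "0 \<le> i mod int n" "i mod int n < int n" using n3 by auto
      then show ?thesis using w_mod[of i] by auto
    qed
    have bij: "bij_betw (\<lambda>a. w (int a)) (pverts (cycle_graph n)) (pverts G)"
      unfolding bij_betw_def
    proof
      show "inj_on (\<lambda>a. w (int a)) (pverts (cycle_graph n))"
        using inj by (auto simp: inj_on_def cycle_graph_def)
      show "(\<lambda>a. w (int a)) ` pverts (cycle_graph n) = pverts G"
      proof -
        have "w i \<in> (\<lambda>a. w (int a)) ` {..<n}" for i
          using im[of i] by (intro image_eqI[of _ _ "nat (i mod int n)"]) auto
        then show ?thesis unfolding V[symmetric] by (auto simp: cycle_graph_def)
      qed
    qed
    have Suc_mod: "w (int (Suc a mod n)) = w (int a + 1)" for a
      using w_mod[of "int a + 1"] by (simp add: zmod_int add.commute)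
    have arc: "(a, b) \<in> parcs (cycle_graph n) \<longleftrightarrow> (w (int a), w (int b)) \<in> parcs G"
      if ab: "a < n" "b < n" for a b
    proof -
      \<comment> \<open>The cyclic predecessor of \<open>a\<close>. For \<open>a = 0\<close>, the
        equality \<open>w (int a') = w (int a - 1)\<close> is periodicity at -1.\<close>
      define a' where "a' = (if a = 0 then n - 1 else a - 1)"
      have a': "a' < n" "Suc a' mod n = a" using ab by (auto simp: a'_def)
      have "w (int a') = w (int a - 1)"
        using period[of "-1"] n3 ab by (auto simp: a'_def of_nat_diff)
      then have "(w (int a), w (int b)) \<in> parcs G \<longleftrightarrow>
          w (int b) = w (int a') \<or> w (int b) = w (int (Suc a mod n))"
        using nb[of "int a"] Suc_mod[of a] by (auto simp: nbs_def)
      also have "\<dots> \<longleftrightarrow> b = a' \<or> b = Suc a mod n"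
        using inj a' ab by (metis mod_less_divisor gr_implies_not0 not_gr_zero)
      also have "b = a' \<longleftrightarrow> a = Suc b mod n"
        using a' ab by (auto simp: a'_def mod_Suc split: if_splits)
      finally show ?thesis using ab by (auto simp: cycle_graph_def)
    qed
    have "digraph_iso (with_proj (cycle_graph n)) (with_proj G)"
      using digraph_iso_with_proj_iff[OF pair_wf_cycle_graph wf] bij arc
      by (fastforce simp: cycle_graph_def)
    then have iso: "digraph_iso (with_proj G) (with_proj (cycle_graph n))"
      using digraph_iso_swap pair_wf_cycle_graph wf_digraph_wp_iff by blast
    have nb': "w (i + 1) \<in> nbs G (w i)" for i by (simp add: nb)
    have "n \<noteq> 4"
    proof
      assume "n = 4"
      then show False
        using no_C4[of "w 0" "w 2" "w 1" "w 3"] inj[of 0 2] inj[of 1 3] period[of 0]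
          nb'[of 0] nb'[of 1] nb'[of 2] nb'[of 3] by auto
    qed
    moreover have "friendship_centre (w 0)" if "n = 3"
      unfolding friendship_centre_def
    proof (intro conjI ballI impI)
      show "w 0 \<in> pverts G" using V by blast
      fix v assume v: "v \<in> pverts G" "v \<noteq> w 0"
      then show "deg G v = 2" using two by blast
      obtain i where "v = w i" using v V by blast
      then have vi: "v = w (i mod 3)" using w_mod[of i] that by simp
      have "i mod 3 = 0 \<or> i mod 3 = 1 \<or> i mod 3 = 2" by presburger
      then have "v = w 1 \<or> v = w 2" using vi v(2) by metis
      moreover have "nbs G (w 0) = {w 2, w 1}"
        using nb[of 0] period[of "-1"] that by simp
      ultimately show "v \<in> nbs G (w 0)" by blast
    qed
    ultimately show ?thesis using iso n3 by (cases "n = 3") (auto intro!: exI[of _ n])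
  qed
qed

section \<open>Assembling the equivalence\<close>

lemma CD_iff:
  "CD_0_infinity G \<longleftrightarrow>
      ((\<exists>n\<ge>5. digraph_iso (with_proj G) (with_proj (cycle_graph n)))
        \<or> digraph_iso (with_proj G) (with_proj infinite_line))
    \<or> (\<exists>k. 1 \<le> k \<and> k \<le> 7 \<and> digraph_iso (with_proj G) (with_proj (friendship_graph k)))"
    (is "_ \<longleftrightarrow> ?L \<or> ?F")
proof
  assume CD: "CD_0_infinity G"
  have F: ?F if c: "friendship_centre c" for c
  proof -
    obtain k where k: "1 \<le> k" "deg G c = 2 * k"
        "digraph_iso (with_proj G) (with_proj (friendship_graph k))"
      using friendship_centre_iso[OF c] by blast
    \<comment> \<open>From \<open>2 * k \<le> 15\<close> it follows that
      \<open>k \<le> 7\<close>.\<close>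
    then show ?F using CD_friendship_deg_le[OF CD c] by (intro exI[of _ k]) auto
  qed
  show "?L \<or> ?F"
  proof (cases "\<exists>c\<in>pverts G. 3 \<le> deg G c")
    case True
    then show ?thesis using CD_deg_ge_3_friendship_centre[OF CD] F by blast
  next
    case False
    then have "deg G v = 2" if "v \<in> pverts G" for v using that deg_ge_2[OF that] by force
    then show ?thesis using two_regular_classification F by blast
  qed
next
  assume "?L \<or> ?F"
  then consider (cycle) n where "5 \<le> n" "digraph_iso (with_proj G) (with_proj (cycle_graph n))"
    | (line) "digraph_iso (with_proj G) (with_proj infinite_line)"
    | (friendship) k where "1 \<le> k" "k \<le> 7" "digraph_iso (with_proj G) (with_proj (friendship_graph k))"
    by blast
  then show "CD_0_infinity G"
  proof cases
    case cycle
    then show ?thesis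
      using deg_cycle_graph[of n] iso_two_regular_imp_CD[OF pair_wf_cycle_graph]
      by (simp add: cycle_graph_def)
  next
    case line
    then show ?thesis
      by (rule iso_two_regular_imp_CD[OF pair_wf_infinite_line]) (rule deg_infinite_line)
  next
    case friendship
    then obtain c where "friendship_centre c" "deg G c = 2 * k"
      using iso_friendship_centre by blast
    then show ?thesis using friendship(2) by (intro friendship_imp_CD) auto
  qed
qed

end

theorem theorem2p6:
  fixes G :: "'a pair_pre_digraph"
  assumes "pair_bidirected_digraph G"
    and "Digraph_Component.connected (with_proj G)"
    and "locally_finite_graph G"
    and "C4_free G"
    and "\<forall>x \<in> pverts G. 2 \<le> out_degree (with_proj G) x"
  shows "CD_0_infinity G \<longleftrightarrow>
      ((\<exists>n\<ge>5. digraph_iso (with_proj G) (with_proj (cycle_graph n)))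
        \<or> digraph_iso (with_proj G) (with_proj infinite_line))
    \<or> (\<exists>k. 1 \<le> k \<and> k \<le> 7 \<and> digraph_iso (with_proj G) (with_proj (friendship_graph k)))"
proof -
  interpret c4_free_graph G
    using assms by (simp add: c4_free_graph_def c4_free_graph_axioms_def)
  show ?thesis by (rule CD_iff)
qed

end
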